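(* Let $G$ be a $P_7$-free graph and let $S$ be a minimal separator in $G$. Then there exists a set $S' \subseteq V(G)$ with $|S'| \leq 22$ such that $S \subseteq N_G[S']$.
   Context: All graphs are finite and simple. $P_t$ denotes the path on $t$ vertices; a graph is $P_t$-free if it has no induced subgraph isomorphic to $P_t$. For $X\subseteq V(G)$, $N_G(X)$ is the set of vertices outside $X$ adjacent to some vertex of $X$, and $N_G[X] = X \cup N_G(X)$ is the closed neighborhood. For $S \subseteq V(G)$, a connected component $A$ of $G - S$ is a full component of $S$ if $N_G(A) = S$. A set $S \subseteq V(G)$ is a minimal separator if $G-S$ has at least two full components of $S$. *)

theory Defs
  imports "Graph_Theory.Graph_Theory"
begin

text \<open>
  Finite simple graphs are modelled by the locale \<open>graph\<close> of Graph_Theory: finite, loop-free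
  digraphs without parallel arcs whose arc relation is symmetric, an edge being represented by its
  two orientations.
\<close>

definition path_graph :: "nat \<Rightarrow> nat pair_pre_digraph" where
  "path_graph t = \<lparr> pverts = {..<t},
     parcs = {(i, j). i < t \<and> j < t \<and> (j = Suc i \<or> i = Suc j)} \<rparr>"

definition path_free :: "nat \<Rightarrow> ('a, 'b) pre_digraph \<Rightarrow> bool" where
  "path_free t G \<longleftrightarrow>
     \<not> (\<exists>H. induced_subgraph H G \<and> digraph_iso H (with_proj (path_graph t)))"

definition neighborhood :: "('a, 'b) pre_digraph \<Rightarrow> 'a set \<Rightarrow> 'a set" where
  "neighborhood G X = {v \<in> verts G - X. \<exists>u \<in> X. u \<rightarrow>\<^bsub>G\<^esub> v}"

definition closed_neighborhood :: "('a, 'b) pre_digraph \<Rightarrow> 'a set \<Rightarrow> 'a set" where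
  "closed_neighborhood G X = X \<union> neighborhood G X"

text \<open>
  The connected components of a graph are its strongly connected components, the arc relation
  being symmetric. They are represented by their vertex sets; \<open>G - S\<close> is the subgraph
  induced by \<open>verts G - S\<close>.
\<close>

definition full_component :: "('a, 'b) pre_digraph \<Rightarrow> 'a set \<Rightarrow> 'a set \<Rightarrow> bool" where
  "full_component G S A \<longleftrightarrow>
     A \<in> pre_digraph.sccs_verts (G \<restriction> (verts G - S)) \<and> neighborhood G A = S"

definition minimal_separator :: "('a, 'b) pre_digraph \<Rightarrow> 'a set \<Rightarrow> bool" where
  "minimal_separator G S \<longleftrightarrow>
     S \<subseteq> verts G \<and> (\<exists>A B. A \<noteq> B \<and> full_component G S A \<and> full_component G S B)"

end

theory Submission
  imports Defs
begin

text \<open>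
  Let \<open>A\<close> and \<open>B\<close> be two full components of \<open>S\<close>. Two vertices \<open>p\<close>, \<open>q\<close> of \<open>A\<close> can be chosen so that
  every vertex of \<open>S\<close> they do not dominate either starts an induced \<open>P\<^sub>4\<close> continuing in \<open>A\<close> or has as
  neighbours in \<open>A\<close> a union of components of the complement of \<open>G[A]\<close>; likewise for \<open>B\<close>. Starting a
  \<open>P\<^sub>4\<close> on both sides gives a \<open>P\<^sub>7\<close>. If \<open>u\<close> is, among the vertices with a \<open>P\<^sub>4\<close> into \<open>B\<close> only, one with
  fewest neighbours in \<open>A\<close>, then that \<open>P\<^sub>4\<close> and a neighbour of \<open>u\<close> in \<open>A\<close> dominate all of them. Among
  the vertices without a \<open>P\<^sub>4\<close> take two whose neighbourhoods are incomparable in both \<open>A\<close> and \<open>B\<close>, with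
  the union of the neighbourhoods in \<open>A\<close> as small as possible. After deleting everything dominated by
  the six vertices of the pair and its private neighbours, any two remaining neighbourhoods are
  comparable in \<open>A\<close> or in \<open>B\<close>, and two more vertices suffice. The total is 4 + 5 + 5 + 8 = 22.
\<close>

unbundle no funcset_syntax

section \<open>Two quasi-orders\<close>

text \<open>Induction on \<open>card X\<close>. In a minimal counterexample, deleting any
  \<open>v\<close> leaves a set with a valid choice \<open>s v\<close>, and this choice can fail
  only against \<open>v\<close> itself. Totality with \<open>x = y\<close> makes every element
  comparable to itself in \<open>P\<close> or \<open>Q\<close>, hence
  \<open>s v \<noteq> v\<close>.\<close>

lemma bi_ranking:
  fixes P Q :: "'a \<Rightarrow> 'a \<Rightarrow> bool"
  assumes fin: "finite X" and "X \<noteq> {}"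
    and transP: "\<And>x y z. P x y \<Longrightarrow> P y z \<Longrightarrow> P x z"
    and transQ: "\<And>x y z. Q x y \<Longrightarrow> Q y z \<Longrightarrow> Q x z"
    and total: "\<And>x y. x \<in> X \<Longrightarrow> y \<in> X \<Longrightarrow> P x y \<or> P y x \<or> Q x y \<or> Q y x"
  shows "\<exists>x\<in>X. \<forall>y\<in>X. P x y \<or> Q x y"
  using assms
proof (induction "card X" arbitrary: X rule: less_induct)
  case less
  show ?case
  proof (rule ccontr)
    assume none: "\<not> ?thesis"
    have "\<exists>w\<in>X. (\<forall>y\<in>X - {v}. P w y \<or> Q w y) \<and> \<not> P w v \<and> \<not> Q w v" if v: "v \<in> X" for v
    proof (cases "X = {v}")
      case True
      then show ?thesis
        using none less.prems(5)[OF v v] by auto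
    next
      case False
      have "card (X - {v}) < card X"
        using v less.prems(1) by (meson card_Diff1_less)
      then have "\<exists>x\<in>X - {v}. \<forall>y\<in>X - {v}. P x y \<or> Q x y"
        by (rule less.hyps) (use v False less.prems in auto)
      then show ?thesis
        using none by blast
    qed
    then obtain s where s: "\<And>v. v \<in> X \<Longrightarrow> s v \<in> X" "\<And>v y. v \<in> X \<Longrightarrow> y \<in> X \<Longrightarrow> y \<noteq> v \<Longrightarrow> P (s v) y \<or> Q (s v) y"
      "\<And>v. v \<in> X \<Longrightarrow> \<not> P (s v) v" "\<And>v. v \<in> X \<Longrightarrow> \<not> Q (s v) v"
      by (metis DiffI singletonD)
    \<comment> \<open>The map \<open>s\<close> never switches from one quasi-order to the other, so iterating it would give an
      infinite strictly increasing sequence.\<close>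
    have no_mono: False
      if R: "R = P \<and> R' = Q \<or> R = Q \<and> R' = P" and T: "T = {v \<in> X. R v (s v)}" "T \<noteq> {}" for R R' T
    proof -
      have trans: "R x z" if "R x y" "R y z" for x y z
        using R that transP transQ by metis
      have trans': "R' x z" if "R' x y" "R' y z" for x y z
        using R that transP transQ by metis
      have "s v \<in> T" if v: "v \<in> T" for v
      proof -
        have vX: "v \<in> X" "R v (s v)" "s v \<in> X" "s (s v) \<in> X"
          using v T s by auto
        have ne: "s v \<noteq> v"
          using s vX total less.prems(5) by metis
        have "R (s v) (s (s v)) \<or> R' (s v) (s (s v))"
          using R s vX less.prems(5) by metis
        moreover have "R (s (s v)) v \<or> R' (s (s v)) v"
          using R s(2)[of "s v" v] vX ne by metis
        moreover have "\<not> R' (s v) v" "\<not> R (s (s v)) (s v)"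
          using R s vX by auto
        \<comment> \<open>\<open>R' (s v) (s (s v))\<close> is impossible. With
          \<open>R' (s (s v)) v\<close> it would give \<open>R' (s v) v\<close>; with
          \<open>R (s (s v)) v\<close> instead, \<open>R v (s v)\<close> gives
          \<open>R (s (s v)) (s v)\<close>.\<close>
        ultimately have "R (s v) (s (s v))"
          using trans trans' vX by metis
        then show ?thesis
          using T vX by auto
      qed
      moreover have "finite T"
        using T less.prems(1) by auto
      moreover define r where "r = {(x, y). x \<in> T \<and> y \<in> T \<and> R x y \<and> \<not> R y x}"
      moreover have "acyclic r"
      proof -
        have "R x y \<and> \<not> R y x" if "(x, y) \<in> r\<^sup>+" for x y
          using that by induction (use trans in \<open>auto simp: r_def\<close>)
        then show ?thesis
          by (auto simp: acyclic_def)
      qed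
      moreover have "finite r"
        by (rule finite_subset[of _ "T \<times> T"]) (use \<open>finite T\<close> in \<open>auto simp: r_def\<close>)
      ultimately have "wf (r\<inverse>)"
        by (metis finite_acyclic_wf_converse)
      then obtain v where v: "v \<in> T" "\<And>y. (y, v) \<in> r\<inverse> \<Longrightarrow> y \<notin> T"
        using T(2) by (metis wfE_min ex_in_conv)
      have "(v, s v) \<in> r"
        using v(1) \<open>\<And>v. v \<in> T \<Longrightarrow> s v \<in> T\<close> T s R by (auto simp: r_def)
      then show False
        using v \<open>\<And>v. v \<in> T \<Longrightarrow> s v \<in> T\<close> by auto
    qed
    obtain v where "v \<in> X"
      using less.prems(2) by auto
    then have "P v (s v) \<or> Q v (s v)"
      using s less.prems(5) by metis
    then show False
      using no_mono[of P Q "{v \<in> X. P v (s v)}"] no_mono[of Q P "{v \<in> X. Q v (s v)}"] \<open>v \<in> X\<close> by auto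
  qed
qed

section \<open>Induced paths\<close>

lemma closed_neighborhood_iff:
  "v \<in> closed_neighborhood G X \<longleftrightarrow> v \<in> X \<or> v \<in> verts G \<and> (\<exists>u\<in>X. u \<rightarrow>\<^bsub>G\<^esub> v)"
  by (auto simp: closed_neighborhood_def neighborhood_def)

context pre_digraph
begin

text \<open>The recursive form lets explicit lists such as \<open>[u, x, y, z]\<close> unfold into
  edges and non-edges. Non-adjacency is required in the forward direction only, which suffices once
  adjacency is symmetric.\<close>

fun induced_path :: "'a list \<Rightarrow> bool" where
  "induced_path [] \<longleftrightarrow> True"
| "induced_path [x] \<longleftrightarrow> x \<in> verts G"
| "induced_path (x # y # zs) \<longleftrightarrow>
     x \<in> verts G \<and> x \<rightarrow> y \<and> (\<forall>z\<in>set zs. z \<noteq> x \<and> \<not> x \<rightarrow> z) \<and> induced_path (y # zs)"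

end

context graph
begin

lemma adj_sym: "x \<rightarrow> y \<longleftrightarrow> y \<rightarrow> x"
  using sym_arcs arcs_ends_symmetric by metis

lemma adj_irrefl [simp]: "\<not> x \<rightarrow> x"
  using adj_not_same by blast

lemma induced_path_distinct: "induced_path xs \<Longrightarrow> distinct xs \<and> set xs \<subseteq> verts G"
  by (induction xs rule: induced_path.induct) auto

lemma induced_path_nth_adj:
  assumes "induced_path xs" "i < length xs" "j < length xs"
  shows "xs ! i \<rightarrow> xs ! j \<longleftrightarrow> j = Suc i \<or> i = Suc j"
  using assms
proof (induction xs arbitrary: i j rule: induced_path.induct)
  case (3 x y zs)
  have *: "x \<rightarrow> (y # zs) ! k \<longleftrightarrow> k = 0" if "k < Suc (length zs)" for k
    using 3(2) that by (cases k) auto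
  show ?case
  proof (cases i; cases j)
    fix i' j' assume "i = Suc i'" "j = Suc j'"
    then show ?thesis using 3 by auto
  next
    fix i' assume "i = Suc i'" "j = 0"
    then show ?thesis using 3(3,4) *[of i'] adj_sym[of x] by auto
  next
    fix j' assume "i = 0" "j = Suc j'"
    then show ?thesis using 3(3,4) *[of j'] by auto
  qed auto
qed auto

text \<open>Sending \<open>xs ! i\<close> to \<open>i\<close> is an isomorphism from the subgraph
  induced by \<open>set xs\<close> onto the path graph.\<close>

lemma path_free_length_neq:
  assumes "path_free t G" "induced_path xs"
  shows "length xs \<noteq> t"
proof
  assume t: "length xs = t"
  have dist: "distinct xs" and sub: "set xs \<subseteq> verts G"
    using induced_path_distinct[OF assms(2)] by auto
  define f where "f = the_inv_into {..<t} ((!) xs)"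
  have bij: "bij_betw ((!) xs) {..<t} (set xs)"
    using dist t by (simp add: bij_betw_nth)
  have f_nth: "f (xs ! i) = i" if "i < t" for i
    using bij that unfolding f_def by (auto simp: bij_betw_def the_inv_into_f_f)
  have mem: "\<exists>i<t. v = xs ! i" if "v \<in> set xs" for v
    using that t by (auto simp: in_set_conv_nth)
  define H where "H = G \<restriction> set xs"
  \<comment> \<open>Arcs of \<open>G\<close> have an abstract type, whereas those of the path graph
    are pairs; an arc goes to the pair of positions of its ends. Absence of parallel arcs makes this
    injective.\<close>
  define h where "h = \<lparr>iso_verts = f, iso_arcs = (\<lambda>e. (f (tail G e), f (head G e))),
    iso_head = snd, iso_tail = fst\<rparr>"
  have adj: "xs ! i \<rightarrow> xs ! j \<longleftrightarrow> j = Suc i \<or> i = Suc j" if "i < t" "j < t" for i j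
    using induced_path_nth_adj[OF assms(2)] that t by blast
  have inj: "inj_on f (set xs)"
    by (rule inj_onI) (metis f_nth mem)
  have "induced_subgraph H G"
    unfolding H_def using sub by (rule induced_induce)
  moreover have "pre_digraph.digraph_isomorphism H h"
  proof -
    have "inj_on (iso_arcs h) (arcs H)"
    proof (rule inj_onI)
      fix e e' assume e: "e \<in> arcs H" "e' \<in> arcs H" and eq: "iso_arcs h e = iso_arcs h e'"
      then have "tail G e = tail G e'" "head G e = head G e'"
        using inj by (auto simp: H_def h_def dest: inj_onD)
      then show "e = e'"
        using e no_multi_arcs[of e e'] by (auto simp: H_def arc_to_ends_def)
    qed
    then show ?thesis
      unfolding pre_digraph.digraph_isomorphism_def
      using inj sub wellformed_induce_subgraph[of "set xs"] by (auto simp: H_def h_def)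
  qed
  moreover have "with_proj (path_graph t) = app_iso h H"
  proof -
    have "f ` set xs = {..<t}"
      using f_nth mem t by (force simp: image_iff in_set_conv_nth)
    moreover have "iso_arcs h ` arcs H = {(i, j). i < t \<and> j < t \<and> (j = Suc i \<or> i = Suc j)}" (is "?L = ?R")
    proof (intro set_eqI iffI)
      fix p assume "p \<in> ?L"
      then obtain e where e: "e \<in> arcs G" "tail G e \<in> set xs" "head G e \<in> set xs"
        "p = (f (tail G e), f (head G e))"
        by (auto simp: H_def h_def)
      then obtain i j where ij: "i < t" "tail G e = xs ! i" "j < t" "head G e = xs ! j"
        using mem by metis
      have "xs ! i \<rightarrow> xs ! j"
        using e ij by (metis in_arcs_imp_in_arcs_ends)
      then show "p \<in> ?R"
        using e ij adj f_nth by auto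
    next
      fix p assume "p \<in> ?R"
      then obtain i j where ij: "p = (i, j)" "i < t" "j < t" "xs ! i \<rightarrow> xs ! j"
        using adj by auto
      then obtain e where "e \<in> arcs G" "tail G e = xs ! i" "head G e = xs ! j"
        by blast
      then show "p \<in> ?L"
        using ij f_nth t by (intro image_eqI[of _ _ e]) (auto simp: H_def h_def)
    qed
    ultimately show ?thesis
      by (simp add: app_iso_def with_proj_def path_graph_def H_def h_def)
  qed
  ultimately show False
    using assms(1) by (auto simp: path_free_def digraph_iso_def)
qed

text \<open>Distinctness of the seven vertices follows from the adjacencies: no two vertices of a P7
  have the same neighbours on it.\<close>

lemma P7_freeD:
  assumes "path_free 7 G"
    and "a \<rightarrow> b" "b \<rightarrow> c" "c \<rightarrow> d" "d \<rightarrow> e" "e \<rightarrow> f" "f \<rightarrow> g"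
    and "\<not> a \<rightarrow> c" "\<not> a \<rightarrow> d" "\<not> a \<rightarrow> e" "\<not> a \<rightarrow> f" "\<not> a \<rightarrow> g"
    and "\<not> b \<rightarrow> d" "\<not> b \<rightarrow> e" "\<not> b \<rightarrow> f" "\<not> b \<rightarrow> g"
    and "\<not> c \<rightarrow> e" "\<not> c \<rightarrow> f" "\<not> c \<rightarrow> g" "\<not> d \<rightarrow> f" "\<not> d \<rightarrow> g" "\<not> e \<rightarrow> g"
  shows False
proof -
  have "\<not> induced_path [a, b, c, d, e, f, g]"
    using path_free_length_neq[OF assms(1), of "[a, b, c, d, e, f, g]"] by auto
  moreover have "{a, b, c, d, e, f, g} \<subseteq> verts G"
    using assms(2-7) by auto
  moreover have "a \<noteq> c" "a \<noteq> d" "a \<noteq> e" "a \<noteq> f" "a \<noteq> g" "b \<noteq> d" "b \<noteq> e" "b \<noteq> f" "b \<noteq> g"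
    "c \<noteq> e" "c \<noteq> f" "c \<noteq> g" "d \<noteq> f" "d \<noteq> g" "e \<noteq> g"
    using assms adj_sym by metis+
  ultimately show False
    using assms by simp
qed

section \<open>Neighbourhood decomposition\<close>

text \<open>
  The neighbours of \<open>u\<close> in \<open>A\<close> form a union of connected components of the complement of \<open>G[A]\<close>.
\<close>

definition nonedge_closed :: "'a \<Rightarrow> 'a set \<Rightarrow> bool" where
  "nonedge_closed u A \<longleftrightarrow> (\<forall>x\<in>A. \<forall>y\<in>A. \<not> x \<rightarrow> y \<longrightarrow> (u \<rightarrow> x \<longleftrightarrow> u \<rightarrow> y))"

definition starts_P4 :: "'a \<Rightarrow> 'a set \<Rightarrow> bool" where
  "starts_P4 u A \<longleftrightarrow> (\<exists>x\<in>A. \<exists>y\<in>A. \<exists>z\<in>A. induced_path [u, x, y, z])"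

text \<open>These are the modules of \<open>G[A]\<close> in the sense of modular decomposition; only
  vertices of \<open>A\<close> can split \<open>M\<close>.\<close>

definition is_module :: "'a set \<Rightarrow> 'a set \<Rightarrow> bool" where
  "is_module A M \<longleftrightarrow> M \<subseteq> A \<and> (\<forall>z\<in>A - M. \<forall>x\<in>M. \<forall>y\<in>M. z \<rightarrow> x \<longleftrightarrow> z \<rightarrow> y)"

lemma is_moduleD: "is_module A M \<Longrightarrow> z \<in> A \<Longrightarrow> z \<notin> M \<Longrightarrow> x \<in> M \<Longrightarrow> y \<in> M \<Longrightarrow> z \<rightarrow> x \<longleftrightarrow> z \<rightarrow> y"
  unfolding is_module_def by blast

text \<open>The common vertex \<open>p\<close> serves as reference: a vertex outside both modules
  sees each element exactly as it sees \<open>p\<close>.\<close>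

lemma is_module_Un:
  assumes "is_module A M" "is_module A N" "p \<in> M" "p \<in> N"
  shows "is_module A (M \<union> N)"
proof -
  have "z \<rightarrow> x \<longleftrightarrow> z \<rightarrow> p" if "z \<in> A - (M \<union> N)" "x \<in> M \<union> N" for z x
    using that assms is_moduleD[of A M z x p] is_moduleD[of A N z x p] by blast
  then show ?thesis
    using assms unfolding is_module_def by blast
qed

text \<open>Take an edge leaving a maximal proper nonempty module \<open>M\<close>, which exists
  because singletons are proper. A proper module \<open>N\<close> containing this edge would satisfy
  \<open>M \<union> N = A\<close> and force \<open>M\<close> to be complete to \<open>A - M\<close>,
  contradicting \<open>coconn\<close>.\<close>

lemma edge_in_no_proper_module:
  assumes fin: "finite A" and two: "a \<in> A" "b \<in> A" "a \<noteq> b"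
    and conn: "\<And>X. X \<subset> A \<Longrightarrow> X \<noteq> {} \<Longrightarrow> \<exists>x\<in>X. \<exists>y\<in>A - X. x \<rightarrow> y"
    and coconn: "\<And>X. X \<subset> A \<Longrightarrow> X \<noteq> {} \<Longrightarrow> \<exists>x\<in>X. \<exists>y\<in>A - X. \<not> x \<rightarrow> y"
  shows "\<exists>p\<in>A. \<exists>q\<in>A. p \<rightarrow> q \<and> (\<forall>N. is_module A N \<longrightarrow> p \<in> N \<longrightarrow> q \<in> N \<longrightarrow> N = A)"
proof -
  define F where "F = {M. is_module A M \<and> M \<noteq> A \<and> M \<noteq> {}}"
  have "finite F"
    by (rule finite_subset[of _ "Pow A"]) (use fin in \<open>auto simp: F_def is_module_def\<close>)
  moreover have "{a} \<in> F"
    using two by (auto simp: F_def is_module_def)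
  ultimately have "\<exists>M\<in>F. \<forall>N\<in>F. M \<subseteq> N \<longrightarrow> M = N"
    by (intro finite_has_maximal) auto
  then obtain M where M: "M \<in> F" and maxM: "\<And>N. N \<in> F \<Longrightarrow> M \<subseteq> N \<Longrightarrow> M = N"
    by blast
  have modM: "is_module A M" and "M \<subset> A" "M \<noteq> {}"
    using M unfolding F_def is_module_def by blast+
  then obtain p q where pq: "p \<in> M" "q \<in> A" "q \<notin> M" "p \<rightarrow> q"
    using conn[OF \<open>M \<subset> A\<close> \<open>M \<noteq> {}\<close>] by blast
  have "N = A" if N: "is_module A N" "p \<in> N" "q \<in> N" for N
  proof (rule ccontr)
    assume "N \<noteq> A"
    have "M \<union> N = A"
      using is_module_Un[OF modM N(1) pq(1) N(2)] maxM[of "M \<union> N"] pq N by (auto simp: F_def)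
    moreover have "N \<subseteq> A"
      using N(1) unfolding is_module_def by blast
    ultimately obtain x where x: "x \<in> M" "x \<notin> N" "x \<in> A"
      using \<open>N \<noteq> A\<close> by blast
    \<comment> \<open>\<open>q\<close> is complete to \<open>M\<close>, so \<open>x\<close> is complete to \<open>N\<close>, which contains everything outside \<open>M\<close>.\<close>
    have "x \<rightarrow> q"
      using is_moduleD[OF modM pq(2,3) x(1) pq(1)] pq(4) adj_sym[of p q] adj_sym[of q x] by blast
    then have "x \<rightarrow> y" if "y \<in> A - M" for y
      using is_moduleD[OF N(1) x(3,2), of y q] that \<open>M \<union> N = A\<close> N(3) by blast
    then have "z \<rightarrow> y" if "y \<in> A - M" "z \<in> M" for y z
      using is_moduleD[OF modM, of y x z] that x(1) adj_sym[of x y] adj_sym[of z y] by blast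
    then show False
      using coconn[OF \<open>M \<subset> A\<close> \<open>M \<noteq> {}\<close>] by blast
  qed
  then show ?thesis
    using pq \<open>M \<subset> A\<close> by blast
qed

text \<open>Unless \<open>A\<close> is a single vertex, either \<open>G[A]\<close> is a join, and
  \<open>p\<close>, \<open>q\<close> come from its two sides, or its complement is connected, and
  \<open>p\<close>, \<open>q\<close> form an edge contained in no proper module.\<close>

lemma neighborhood_decomposition:
  assumes fin: "finite A" and "A \<noteq> {}" and sub: "A \<subseteq> verts G"
    and conn: "\<And>X. X \<subset> A \<Longrightarrow> X \<noteq> {} \<Longrightarrow> \<exists>x\<in>X. \<exists>y\<in>A - X. x \<rightarrow> y"
  shows "\<exists>p\<in>A. \<exists>q\<in>A. \<forall>u\<in>neighborhood G A.
           u \<rightarrow> p \<or> u \<rightarrow> q \<or> starts_P4 u A \<or> nonedge_closed u A"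
proof -
  obtain a where a: "a \<in> A"
    using \<open>A \<noteq> {}\<close> by blast
  consider (single) "A = {a}"
    | (join) X where "X \<subset> A" "X \<noteq> {}" "\<forall>x\<in>X. \<forall>y\<in>A - X. x \<rightarrow> y"
    | (prime) "A \<noteq> {a}" "\<not> (\<exists>X. X \<subset> A \<and> X \<noteq> {} \<and> (\<forall>x\<in>X. \<forall>y\<in>A - X. x \<rightarrow> y))"
    by metis
  then show ?thesis
  proof cases
    case single
    then show ?thesis
      by (auto simp: nonedge_closed_def)
  next
    case join
    then obtain p q where pq: "p \<in> X" "q \<in> A - X" "p \<in> A"
      by blast
    have "starts_P4 u A"
      if u: "u \<in> neighborhood G A" "\<not> u \<rightarrow> p" "\<not> u \<rightarrow> q" "\<not> nonedge_closed u A" for u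
    proof -
      obtain x y where xy: "x \<in> A" "y \<in> A" "\<not> x \<rightarrow> y" "u \<rightarrow> x" "\<not> u \<rightarrow> y"
        using u(4) adj_sym unfolding nonedge_closed_def by blast
      have "\<not> (x \<in> X \<and> y \<notin> X)" "\<not> (x \<notin> X \<and> y \<in> X)"
        using xy(1-3) join(3) adj_sym[of x y] by blast+
      then consider "x \<in> X" "y \<in> X" | "x \<in> A - X" "y \<in> A - X"
        using xy(1,2) by blast
      \<comment> \<open>A non-edge cannot cross the join, so \<open>x\<close> and \<open>y\<close>
        lie on one side. The chosen vertex \<open>p\<close> or \<open>q\<close> of the other side is
        adjacent to both and missed by \<open>u\<close>.\<close>
      then have "\<exists>r\<in>A. \<not> u \<rightarrow> r \<and> x \<rightarrow> r \<and> r \<rightarrow> y"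
      proof cases
        case 1
        then show ?thesis
          using pq(2) u(3) join(3) adj_sym[of q y] by blast
      next
        case 2
        then show ?thesis
          using pq(1,3) u(2) join(3) adj_sym[of x p] by blast
      qed
      then obtain r where "r \<in> A" "\<not> u \<rightarrow> r" "x \<rightarrow> r" "r \<rightarrow> y"
        by blast
      then have "induced_path [u, x, r, y]"
        using xy u(1) sub by (auto simp: neighborhood_def)
      then show ?thesis
        using xy \<open>r \<in> A\<close> unfolding starts_P4_def by blast
    qed
    then show ?thesis
      using pq by blast
  next
    case prime
    then obtain b where b: "b \<in> A" "a \<noteq> b"
      using a by auto
    have coconn: "\<exists>x\<in>X. \<exists>y\<in>A - X. \<not> x \<rightarrow> y" if "X \<subset> A" "X \<noteq> {}" for X
      using prime(2) that by blast
    obtain p q where pq: "p \<in> A" "q \<in> A" "p \<rightarrow> q"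
      and noproper: "\<And>N. is_module A N \<Longrightarrow> p \<in> N \<Longrightarrow> q \<in> N \<Longrightarrow> N = A"
      using edge_in_no_proper_module[OF fin a b conn coconn] by blast
    have "starts_P4 u A"
      if u: "u \<in> neighborhood G A" "\<not> u \<rightarrow> p" "\<not> u \<rightarrow> q" for u
    proof (rule ccontr)
      assume no_P4: "\<not> starts_P4 u A"
      \<comment> \<open>The component of \<open>p\<close> among the non-neighbours of \<open>u\<close> is a proper module containing the edge.\<close>
      define R where "R = {(x, y). x \<in> A \<and> y \<in> A \<and> \<not> u \<rightarrow> x \<and> \<not> u \<rightarrow> y \<and> x \<rightarrow> y}"
      define C where "C = {c. (p, c) \<in> R\<^sup>*}"
      have C: "c \<in> A \<and> \<not> u \<rightarrow> c" if "c \<in> C" for c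
        using that pq u unfolding C_def mem_Collect_eq
        by (induction rule: rtrancl_induct) (auto simp: R_def)
      have closed: "d \<in> C" if "c \<in> C" "d \<in> A" "c \<rightarrow> d" "\<not> u \<rightarrow> d" for c d
        using that C[OF that(1)] unfolding C_def R_def
        by (auto intro: rtrancl.rtrancl_into_rtrancl)
      have "p \<in> C"
        by (simp add: C_def)
      have "q \<in> C"
        using closed[OF \<open>p \<in> C\<close>] pq u by blast
      \<comment> \<open>A non-neighbour of \<open>u\<close> outside the component \<open>C\<close>
        sees nothing of \<open>C\<close>. A neighbour \<open>z\<close> of \<open>u\<close> cannot
        distinguish the ends of an edge of \<open>C\<close>, since that would yield an induced P4
        starting with \<open>u\<close>, \<open>z\<close>; the claim then spreads from
        \<open>p\<close> along walks in \<open>C\<close>.\<close>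
      have "z \<rightarrow> c \<longleftrightarrow> z \<rightarrow> p" if z: "z \<in> A - C" and c: "c \<in> C" for z c
      proof (cases "u \<rightarrow> z")
        case False
        then show ?thesis
          using closed[OF c, of z] closed[OF \<open>p \<in> C\<close>, of z] z adj_sym by blast
      next
        case True
        have switch: False if "c \<in> C" "d \<in> C" "c \<rightarrow> d" "z \<rightarrow> c" "\<not> z \<rightarrow> d" for c d
        proof -
          have "induced_path [u, z, c, d]"
            using that z True C[of c] C[of d] u(1) sub by (auto simp: neighborhood_def)
          then show False
            using no_P4 that z C unfolding starts_P4_def by blast
        qed
        have "(p, c) \<in> R\<^sup>*"
          using c by (simp add: C_def)
        then show ?thesis
        proof (induction rule: rtrancl_induct)
          case (step c d)
          then have "(p, d) \<in> R\<^sup>*"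
            by (meson rtrancl.rtrancl_into_rtrancl)
          then have "c \<in> C" "d \<in> C" "c \<rightarrow> d"
            using step.hyps by (auto simp: C_def R_def)
          then show ?case
            using switch[of c d] switch[of d c] step.IH adj_sym by blast
        qed simp
      qed
      then have "is_module A C"
        using C unfolding is_module_def by blast
      then have "C = A"
        using noproper \<open>p \<in> C\<close> \<open>q \<in> C\<close> by blast
      moreover obtain x where "x \<in> A" "u \<rightarrow> x"
        using u(1) adj_sym by (auto simp: neighborhood_def)
      ultimately show False
        using C by blast
    qed
    then show ?thesis
      using pq by blast
  qed
qed

section \<open>Covering the separator\<close>

text \<open>An undominated \<open>v\<close> would have a neighbour \<open>a'\<close> in
  \<open>A\<close> missed by \<open>u\<close>, and \<open>v, a', a, u, b1, b2, b3\<close> would be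
  an induced P7.\<close>

lemma cover_starts_P4:
  assumes P7: "path_free 7 G" and AB: "A \<subseteq> verts G" "B \<subseteq> verts G" "A \<inter> B = {}"
    and anti: "\<And>x y. x \<in> A \<Longrightarrow> y \<in> B \<Longrightarrow> \<not> x \<rightarrow> y"
    and T: "T \<subseteq> neighborhood G A" "T \<inter> B = {}"
      "\<And>u. u \<in> T \<Longrightarrow> nonedge_closed u A" "\<And>u. u \<in> T \<Longrightarrow> starts_P4 u B"
  shows "\<exists>C \<subseteq> verts G. card C \<le> 5 \<and> T \<subseteq> closed_neighborhood G C"
proof (cases "T = {}")
  case True
  then show ?thesis
    by (intro exI[of _ "{}"]) auto
next
  case False
  have TG: "T \<subseteq> verts G" "T \<inter> A = {}"
    using T(1) by (auto simp: neighborhood_def)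
  have finA: "finite A"
    using AB(1) finite_verts finite_subset by blast
  define n where "n u = {a \<in> A. u \<rightarrow> a}" for u
  obtain u where u: "u \<in> T" and min: "\<And>v. v \<in> T \<Longrightarrow> card (n u) \<le> card (n v)"
    using False ex_has_least_nat[of "\<lambda>u. u \<in> T" _ "\<lambda>u. card (n u)"] by blast
  obtain b1 b2 b3 where b: "b1 \<in> B" "b2 \<in> B" "b3 \<in> B" and path: "induced_path [u, b1, b2, b3]"
    using T(4)[OF u] unfolding starts_P4_def by blast
  obtain a where a: "a \<in> A" "u \<rightarrow> a"
    using T(1) u adj_sym by (auto simp: neighborhood_def)
  let ?C = "set [u, a, b1, b2, b3]"
  have "v \<in> closed_neighborhood G ?C" if v: "v \<in> T" for v
  proof (rule ccontr)
    assume "v \<notin> closed_neighborhood G ?C"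
    then have nv: "v \<noteq> u" "\<not> u \<rightarrow> v" "\<not> a \<rightarrow> v" "\<not> b1 \<rightarrow> v" "\<not> b2 \<rightarrow> v" "\<not> b3 \<rightarrow> v"
      using v TG by (auto simp: closed_neighborhood_iff)
    \<comment> \<open>Since \<open>a\<close> is seen by \<open>u\<close> but not by
      \<open>v\<close>, an inclusion \<open>n v \<subseteq> n u\<close> would be strict and
      contradict the minimal choice of \<open>u\<close>.\<close>
    have "\<not> n v \<subset> n u"
      using min[OF v] psubset_card_mono[of "n u" "n v"] finA by (auto simp: n_def)
    moreover have "a \<in> n u" "a \<notin> n v"
      using a nv adj_sym by (auto simp: n_def)
    ultimately obtain a' where a': "a' \<in> A" "v \<rightarrow> a'" "\<not> u \<rightarrow> a'"
      by (auto simp: n_def)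
    have "a \<rightarrow> a'"
      using T(3)[OF u] a a' unfolding nonedge_closed_def by blast
    have path: "u \<rightarrow> b1" "b1 \<rightarrow> b2" "b2 \<rightarrow> b3" "\<not> u \<rightarrow> b2" "\<not> u \<rightarrow> b3" "\<not> b1 \<rightarrow> b3"
      using path by auto
    show False
      by (rule P7_freeD[OF P7, of v a' a u b1 b2 b3])
        (use path a a' nv \<open>a \<rightarrow> a'\<close> b anti adj_sym in metis)+
  qed
  moreover have "?C \<subseteq> verts G"
    using a b u AB TG by auto
  moreover have "card ?C \<le> 5"
    by (rule order_trans[OF card_length]) simp
  ultimately show ?thesis
    by blast
qed

text \<open>By \<open>bi_ranking\<close>, some \<open>x\<close> has, for each \<open>y\<close>, its
  neighbourhood in \<open>A\<close> or in \<open>B\<close> included in that of \<open>y\<close>. One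
  neighbour of \<open>x\<close> in \<open>A\<close> and one in \<open>B\<close> therefore dominate
  everything.\<close>

lemma cover_comparable:
  assumes "finite Y" "Y \<subseteq> neighborhood G A" "Y \<subseteq> neighborhood G B" "A \<subseteq> verts G" "B \<subseteq> verts G"
    and "\<And>u v. u \<in> Y \<Longrightarrow> v \<in> Y \<Longrightarrow>
      {a \<in> A. u \<rightarrow> a} \<subseteq> {a \<in> A. v \<rightarrow> a} \<or> {a \<in> A. v \<rightarrow> a} \<subseteq> {a \<in> A. u \<rightarrow> a} \<or>
      {b \<in> B. u \<rightarrow> b} \<subseteq> {b \<in> B. v \<rightarrow> b} \<or> {b \<in> B. v \<rightarrow> b} \<subseteq> {b \<in> B. u \<rightarrow> b}"
  shows "\<exists>C \<subseteq> verts G. card C \<le> 2 \<and> Y \<subseteq> closed_neighborhood G C"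
proof (cases "Y = {}")
  case True
  then show ?thesis
    by (intro exI[of _ "{}"]) auto
next
  case False
  have "\<exists>x\<in>Y. \<forall>y\<in>Y. {a \<in> A. x \<rightarrow> a} \<subseteq> {a \<in> A. y \<rightarrow> a} \<or> {b \<in> B. x \<rightarrow> b} \<subseteq> {b \<in> B. y \<rightarrow> b}"
    by (rule bi_ranking[OF assms(1) False]) (blast, blast, use assms(6) in blast)
  then obtain x where x: "x \<in> Y"
    "\<And>y. y \<in> Y \<Longrightarrow> {a \<in> A. x \<rightarrow> a} \<subseteq> {a \<in> A. y \<rightarrow> a} \<or> {b \<in> B. x \<rightarrow> b} \<subseteq> {b \<in> B. y \<rightarrow> b}"
    by blast
  obtain a b where ab: "a \<in> A" "b \<in> B" "x \<rightarrow> a" "x \<rightarrow> b"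
    using x(1) assms(2,3) adj_sym unfolding neighborhood_def by blast
  have "y \<in> closed_neighborhood G {a, b}" if y: "y \<in> Y" for y
  proof -
    have "a \<rightarrow> y \<or> b \<rightarrow> y"
      using x(2)[OF y] ab adj_sym by blast
    then show ?thesis
      using y assms(2) by (auto simp: closed_neighborhood_iff neighborhood_def)
  qed
  moreover have "{a, b} \<subseteq> verts G" "card {a, b} \<le> 2"
    using ab assms(4,5) by (auto simp: card_insert_if)
  ultimately show ?thesis
    by blast
qed

text \<open>The bound is 6 for an extremal incomparable pair with its private neighbours, plus 2
  from \<open>cover_comparable\<close>. The vertex \<open>p\<close> ends the forbidden path when
  that pair is adjacent.\<close>

lemma cover_nonedge_closed:
  assumes P7: "path_free 7 G" and AB: "A \<subseteq> verts G" "B \<subseteq> verts G" "A \<inter> B = {}"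
    and anti: "\<And>x y. x \<in> A \<Longrightarrow> y \<in> B \<Longrightarrow> \<not> x \<rightarrow> y"
    and Y: "Y \<subseteq> neighborhood G A" "Y \<subseteq> neighborhood G B"
      "\<And>u. u \<in> Y \<Longrightarrow> nonedge_closed u A" "\<And>u. u \<in> Y \<Longrightarrow> nonedge_closed u B"
    and p: "p \<in> B" "\<And>u. u \<in> Y \<Longrightarrow> \<not> u \<rightarrow> p"
  shows "\<exists>C \<subseteq> verts G. card C \<le> 8 \<and> Y \<subseteq> closed_neighborhood G C"
proof -
  have YG: "Y \<subseteq> verts G" "Y \<inter> A = {}" "Y \<inter> B = {}"
    using Y(1,2) by (auto simp: neighborhood_def)
  have fin: "finite A" "finite Y"
    using AB(1) YG(1) finite_verts finite_subset by blast+
  define n where "n D u = {d \<in> D. u \<rightarrow> d}" for D u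
  define incomparable where "incomparable u v \<longleftrightarrow> u \<in> Y \<and> v \<in> Y \<and>
    \<not> n A u \<subseteq> n A v \<and> \<not> n A v \<subseteq> n A u \<and> \<not> n B u \<subseteq> n B v \<and> \<not> n B v \<subseteq> n B u" for u v
  have comparable: "\<exists>C \<subseteq> verts G. card C \<le> 2 \<and> Z \<subseteq> closed_neighborhood G C"
    if "Z \<subseteq> Y" "\<And>u v. u \<in> Z \<Longrightarrow> v \<in> Z \<Longrightarrow> \<not> incomparable u v" for Z
  proof (rule cover_comparable[OF _ _ _ AB(1,2)])
    show "finite Z"
      using that(1) fin(2) finite_subset by blast
    show "Z \<subseteq> neighborhood G A" "Z \<subseteq> neighborhood G B"
      using that(1) Y(1,2) by auto
    show "{a \<in> A. u \<rightarrow> a} \<subseteq> {a \<in> A. v \<rightarrow> a} \<or> {a \<in> A. v \<rightarrow> a} \<subseteq> {a \<in> A. u \<rightarrow> a} \<or>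
      {b \<in> B. u \<rightarrow> b} \<subseteq> {b \<in> B. v \<rightarrow> b} \<or> {b \<in> B. v \<rightarrow> b} \<subseteq> {b \<in> B. u \<rightarrow> b}"
      if "u \<in> Z" "v \<in> Z" for u v
      using \<open>\<And>u v. u \<in> Z \<Longrightarrow> v \<in> Z \<Longrightarrow> \<not> incomparable u v\<close>[OF that] that \<open>Z \<subseteq> Y\<close>
      unfolding incomparable_def n_def by blast
  qed
  show ?thesis
  proof (cases "\<exists>u v. incomparable u v")
    case False
    then obtain C where "C \<subseteq> verts G" "card C \<le> 2" "Y \<subseteq> closed_neighborhood G C"
      using comparable[of Y] by blast
    then show ?thesis
      by (intro exI[of _ C]) auto
  next
    case True
    then obtain u v where uv: "incomparable u v"
      and min: "\<And>w x. incomparable w x \<Longrightarrow> card (n A u \<union> n A v) \<le> card (n A w \<union> n A x)"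
      using ex_has_least_nat[of "\<lambda>(u, v). incomparable u v" _ "\<lambda>(u, v). card (n A u \<union> n A v)"]
      unfolding split_paired_All split_paired_Ex prod.case by blast
    have uvY: "u \<in> Y" "v \<in> Y"
      using uv by (auto simp: incomparable_def)
    obtain a\<^sub>u a\<^sub>v where a: "a\<^sub>u \<in> A" "a\<^sub>v \<in> A" "u \<rightarrow> a\<^sub>u" "\<not> v \<rightarrow> a\<^sub>u" "v \<rightarrow> a\<^sub>v" "\<not> u \<rightarrow> a\<^sub>v"
      using uv by (auto simp: incomparable_def n_def)
    obtain b\<^sub>u b\<^sub>v where b: "b\<^sub>u \<in> B" "b\<^sub>v \<in> B" "u \<rightarrow> b\<^sub>u" "\<not> v \<rightarrow> b\<^sub>u" "v \<rightarrow> b\<^sub>v" "\<not> u \<rightarrow> b\<^sub>v"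
      using uv by (auto simp: incomparable_def n_def)
    let ?C = "set [u, v, a\<^sub>u, a\<^sub>v, b\<^sub>u, b\<^sub>v]"
    define Z where "Z = Y - closed_neighborhood G ?C"
    have Z: "w \<in> Y" "w \<noteq> u" "w \<noteq> v" "\<not> w \<rightarrow> u" "\<not> w \<rightarrow> v"
      "\<not> w \<rightarrow> a\<^sub>u" "\<not> w \<rightarrow> a\<^sub>v" "\<not> w \<rightarrow> b\<^sub>u" "\<not> w \<rightarrow> b\<^sub>v" if "w \<in> Z" for w
      using that YG adj_sym by (auto simp: Z_def closed_neighborhood_iff)
    have sub: "n A w \<subseteq> n A u \<union> n A v" if w: "w \<in> Z" for w
    proof (rule ccontr)
      assume "\<not> ?thesis"
      then obtain c where c: "c \<in> A" "w \<rightarrow> c" "\<not> u \<rightarrow> c" "\<not> v \<rightarrow> c"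
        by (auto simp: n_def)
      have "c \<rightarrow> a\<^sub>u"
        using Y(3)[OF uvY(1)] c(1,3) a(1,3) unfolding nonedge_closed_def by blast
      moreover have "a\<^sub>u \<rightarrow> u" "\<not> a\<^sub>u \<rightarrow> v" "\<not> c \<rightarrow> u" "\<not> c \<rightarrow> v"
        using a c by (auto simp: adj_sym)
      ultimately have path: "w \<rightarrow> c" "c \<rightarrow> a\<^sub>u" "a\<^sub>u \<rightarrow> u" "\<not> w \<rightarrow> a\<^sub>u" "\<not> w \<rightarrow> u" "\<not> w \<rightarrow> v"
        "\<not> c \<rightarrow> u" "\<not> c \<rightarrow> v" "\<not> a\<^sub>u \<rightarrow> v"
        using Z[OF w] c by auto
      show False
      \<comment> \<open>The induced path \<open>w, c, a\<^sub>u, u\<close> extends to a P7 by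
        \<open>v, b\<^sub>v, p\<close> if \<open>u\<close> and \<open>v\<close> are adjacent, and by
        \<open>b\<^sub>u, b\<^sub>v, v\<close> otherwise. The edge at \<open>b\<^sub>v\<close> into
        \<open>B\<close> comes from \<open>nonedge_closed\<close> in both cases: \<open>v\<close>
        separates \<open>b\<^sub>v\<close> from \<open>p\<close>, and \<open>u\<close> separates
        \<open>b\<^sub>u\<close> from \<open>b\<^sub>v\<close>.\<close>
      proof (cases "u \<rightarrow> v")
        case True
        have "b\<^sub>v \<rightarrow> p"
          using Y(4)[OF uvY(2)] b p(1) p(2)[OF uvY(2)] unfolding nonedge_closed_def by blast
        then show False
          by (intro P7_freeD[OF P7, of w c "a\<^sub>u" u v "b\<^sub>v" p])
            (use True path Z[OF w] a b c p uvY anti in auto)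
      next
        case False
        have "b\<^sub>u \<rightarrow> b\<^sub>v"
          using Y(4)[OF uvY(1)] b unfolding nonedge_closed_def by blast
        then show False
          by (intro P7_freeD[OF P7, of w c "a\<^sub>u" u "b\<^sub>u" "b\<^sub>v" v])
            (use False path Z[OF w] a b c anti adj_sym[of "b\<^sub>u" v] adj_sym[of "b\<^sub>v" v] in auto)
      qed
    qed
    have "\<not> incomparable w x" if wx: "w \<in> Z" "x \<in> Z" for w x
    proof
      assume "incomparable w x"
      then have "card (n A u \<union> n A v) \<le> card (n A w \<union> n A x)"
        by (rule min)
      \<comment> \<open>The inclusion is strict because \<open>a\<^sub>u\<close> is a neighbour of
        \<open>u\<close> that both \<open>w\<close> and \<open>x\<close> miss; so the pair
        \<open>w\<close>, \<open>x\<close> would beat the minimal one.\<close>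
      moreover have "n A w \<union> n A x \<subset> n A u \<union> n A v"
        using sub[OF wx(1)] sub[OF wx(2)] Z(6)[OF wx(1)] Z(6)[OF wx(2)] a by (auto simp: n_def)
      moreover have "finite (n A u \<union> n A v)"
        using fin(1) by (auto simp: n_def)
      ultimately show False
        using psubset_card_mono[of "n A u \<union> n A v" "n A w \<union> n A x"] by linarith
    qed
    then obtain C where C: "C \<subseteq> verts G" "card C \<le> 2" "Z \<subseteq> closed_neighborhood G C"
      using comparable[of Z] by (auto simp: Z_def)
    have "card ?C \<le> 6"
      by (rule order_trans[OF card_length]) simp
    then have "card (?C \<union> C) \<le> 8"
      using C(2) card_Un_le[of ?C C] by linarith
    moreover have "?C \<union> C \<subseteq> verts G"
      using C(1) a b uvY YG AB by auto
    moreover have "Y \<subseteq> closed_neighborhood G (?C \<union> C)"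
      using C(3) unfolding Z_def subset_iff Diff_iff closed_neighborhood_iff by blast
    ultimately show ?thesis
      by blast
  qed
qed

section \<open>Full components as connected vertex sets\<close>

text \<open>The last conclusion is connectivity in cut form: a set \<open>X\<close> with no edge to
  \<open>A - X\<close> is closed under steps in \<open>G - S\<close>, so reachability cannot leave
  it.\<close>

lemma full_componentD:
  assumes "full_component G S A"
  shows "A \<noteq> {}" "A \<subseteq> verts G - S" "neighborhood G A = S"
    "\<And>X. X \<subset> A \<Longrightarrow> X \<noteq> {} \<Longrightarrow> \<exists>x\<in>X. \<exists>y\<in>A - X. x \<rightarrow> y"
proof -
  let ?H = "G \<restriction> (verts G - S)"
  interpret H: wf_digraph ?H
    by (rule wellformed_induce_subgraph)
  have A: "A \<noteq> {}" "\<And>x y. x \<in> A \<Longrightarrow> y \<in> A \<Longrightarrow> x \<rightarrow>\<^sup>*\<^bsub>?H\<^esub> y"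
    using assms by (auto simp: full_component_def H.in_sccs_verts_conv_reachable)
  show N: "neighborhood G A = S"
    using assms by (simp add: full_component_def)
  show "A \<noteq> {}"
    by fact
  show sub: "A \<subseteq> verts G - S"
    using A(2) H.reachable_in_verts(1) by fastforce
  fix X assume X: "X \<subset> A" "X \<noteq> {}"
  then obtain x y where xy: "x \<in> X" "y \<in> A" "y \<notin> X"
    by blast
  show "\<exists>x\<in>X. \<exists>y\<in>A - X. x \<rightarrow> y"
  proof (rule ccontr)
    assume no: "\<not> ?thesis"
    have "x \<rightarrow>\<^sup>*\<^bsub>?H\<^esub> y"
      using A(2) xy X by blast
    then have "y \<in> X"
    proof (induction rule: H.reachable_induct)
      case base
      show ?case by fact
    next
      case (step y z)
      have yz: "y \<rightarrow> z" "z \<in> verts G - S"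
        using step(2) H.adj_in_verts(2)[OF step(2)] by (auto dest: dominates_induce_subgraphD)
      \<comment> \<open>Leaving \<open>A\<close> by an edge would lead into
        \<open>neighborhood G A = S\<close>, but \<open>z\<close> avoids \<open>S\<close>.\<close>
      then have "z \<in> A"
        using step.IH X N by (auto simp: neighborhood_def)
      then show ?case
        using no yz step.IH by blast
    qed
    then show False
      using xy by blast
  qed
qed

end

section \<open>Assembly of the dominating set\<close>

theorem theorem1p3:
  fixes G :: "('a, 'b) pre_digraph" and S :: "'a set"
  assumes "graph G"
    and "path_free 7 G"
    and "minimal_separator G S"
  shows "\<exists>S'. S' \<subseteq> verts G \<and> card S' \<le> 22 \<and> S \<subseteq> closed_neighborhood G S'"
proof -
  interpret graph G by fact
  obtain A B where "A \<noteq> B" and full: "full_component G S A" "full_component G S B"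
    and SG: "S \<subseteq> verts G"
    using assms(3) by (auto simp: minimal_separator_def)
  note A = full_componentD[OF full(1)] and B = full_componentD[OF full(2)]
  interpret H: wf_digraph "G \<restriction> (verts G - S)"
    by (rule wellformed_induce_subgraph)
  have disj: "A \<inter> B = {}"
    using H.sccs_verts_disjoint \<open>A \<noteq> B\<close> full by (auto simp: full_component_def)
  have sub: "A \<subseteq> verts G" "B \<subseteq> verts G" "S \<inter> A = {}" "S \<inter> B = {}"
    using A(2) B(2) by auto
  \<comment> \<open>An edge from \<open>A\<close> to \<open>B\<close> would put its end
    \<open>y\<close> into \<open>neighborhood G A = S\<close>, which is disjoint from
    \<open>B\<close>.\<close>
  have anti: "\<not> x \<rightarrow>\<^bsub>G\<^esub> y" if "x \<in> A" "y \<in> B" for x y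
    using that A(3) sub disj by (auto simp: neighborhood_def)
  have anti': "\<not> x \<rightarrow>\<^bsub>G\<^esub> y" if "x \<in> B" "y \<in> A" for x y
    using anti[OF that(2,1)] adj_sym by blast
  have fin: "finite A" "finite B"
    using sub finite_verts finite_subset by blast+
  obtain p q where pq: "p \<in> A" "q \<in> A"
    "\<And>u. u \<in> S \<Longrightarrow> u \<rightarrow>\<^bsub>G\<^esub> p \<or> u \<rightarrow>\<^bsub>G\<^esub> q \<or> starts_P4 u A \<or> nonedge_closed u A"
    using neighborhood_decomposition[OF fin(1) A(1) sub(1) A(4)] A(3) by auto
  obtain r s where rs: "r \<in> B" "s \<in> B"
    "\<And>u. u \<in> S \<Longrightarrow> u \<rightarrow>\<^bsub>G\<^esub> r \<or> u \<rightarrow>\<^bsub>G\<^esub> s \<or> starts_P4 u B \<or> nonedge_closed u B"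
    using neighborhood_decomposition[OF fin(2) B(1) sub(2) B(4)] B(3) by auto
  define U where "U = S - closed_neighborhood G (set [p, q, r, s])"
  have U: "u \<in> S" "\<not> u \<rightarrow>\<^bsub>G\<^esub> p" "\<not> u \<rightarrow>\<^bsub>G\<^esub> q" "\<not> u \<rightarrow>\<^bsub>G\<^esub> r" "\<not> u \<rightarrow>\<^bsub>G\<^esub> s" if "u \<in> U" for u
    using that SG adj_sym by (auto simp: U_def closed_neighborhood_iff)
  \<comment> \<open>The two P4s share only \<open>u\<close>, and there are no edges between
    \<open>A\<close> and \<open>B\<close>, so glued at \<open>u\<close> they form an induced
    P7.\<close>
  have no_two_P4: False if u: "starts_P4 u A" "starts_P4 u B" for u
  proof -
    obtain x y z where A': "x \<in> A" "y \<in> A" "z \<in> A"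
      "u \<rightarrow>\<^bsub>G\<^esub> x" "x \<rightarrow>\<^bsub>G\<^esub> y" "y \<rightarrow>\<^bsub>G\<^esub> z" "\<not> u \<rightarrow>\<^bsub>G\<^esub> y" "\<not> u \<rightarrow>\<^bsub>G\<^esub> z" "\<not> x \<rightarrow>\<^bsub>G\<^esub> z"
      using u(1) by (auto simp: starts_P4_def)
    obtain x' y' z' where B': "x' \<in> B" "y' \<in> B" "z' \<in> B"
      "u \<rightarrow>\<^bsub>G\<^esub> x'" "x' \<rightarrow>\<^bsub>G\<^esub> y'" "y' \<rightarrow>\<^bsub>G\<^esub> z'" "\<not> u \<rightarrow>\<^bsub>G\<^esub> y'" "\<not> u \<rightarrow>\<^bsub>G\<^esub> z'" "\<not> x' \<rightarrow>\<^bsub>G\<^esub> z'"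
      using u(2) by (auto simp: starts_P4_def)
    show False
      by (rule P7_freeD[OF assms(2), of z y x u x' y' z']) (use A' B' anti adj_sym in metis)+
  qed
  define T where "T = {u \<in> U. nonedge_closed u A \<and> starts_P4 u B}"
  define T' where "T' = {u \<in> U. nonedge_closed u B \<and> starts_P4 u A}"
  define Y where "Y = {u \<in> U. nonedge_closed u A \<and> nonedge_closed u B}"
  have U_sub: "U \<subseteq> T \<union> T' \<union> Y"
    using pq(3) rs(3) U no_two_P4 unfolding T_def T'_def Y_def by blast
  have "\<exists>C \<subseteq> verts G. card C \<le> 5 \<and> T \<subseteq> closed_neighborhood G C"
    by (rule cover_starts_P4[OF assms(2) sub(1,2) disj anti])
      (use U(1) sub A(3) in \<open>auto simp: T_def\<close>)
  then obtain C1 where C1: "C1 \<subseteq> verts G" "card C1 \<le> 5" "T \<subseteq> closed_neighborhood G C1"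
    by blast
  have "\<exists>C \<subseteq> verts G. card C \<le> 5 \<and> T' \<subseteq> closed_neighborhood G C"
    by (rule cover_starts_P4[OF assms(2) sub(2,1) _ anti'])
      (use U(1) sub B(3) disj in \<open>auto simp: T'_def\<close>)
  then obtain C2 where C2: "C2 \<subseteq> verts G" "card C2 \<le> 5" "T' \<subseteq> closed_neighborhood G C2"
    by blast
  \<comment> \<open>The vertex of \<open>B\<close> missed by all of \<open>Y\<close> is
    \<open>r\<close>, because the neighbours of \<open>r\<close> were removed in forming
    \<open>U\<close>.\<close>
  have "\<exists>C \<subseteq> verts G. card C \<le> 8 \<and> Y \<subseteq> closed_neighborhood G C"
    by (rule cover_nonedge_closed[OF assms(2) sub(1,2) disj anti _ _ _ _ rs(1)])
      (use U A(3) B(3) in \<open>auto simp: Y_def\<close>)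
  then obtain C3 where C3: "C3 \<subseteq> verts G" "card C3 \<le> 8" "Y \<subseteq> closed_neighborhood G C3"
    by blast
  let ?C = "set [p, q, r, s]"
  have "S \<subseteq> closed_neighborhood G (?C \<union> C1 \<union> C2 \<union> C3)"
  proof -
    have "S \<subseteq> closed_neighborhood G ?C \<union> T \<union> T' \<union> Y"
      using U_sub U_def by blast
    then show ?thesis
      using C1(3) C2(3) C3(3) unfolding subset_iff Un_iff closed_neighborhood_iff by blast
  qed
  moreover have "card (?C \<union> C1 \<union> C2 \<union> C3) \<le> 22"
  proof -
    have "card ?C \<le> 4"
      by (rule order_trans[OF card_length]) simp
    then show ?thesis
      using card_Un_le[of ?C C1] card_Un_le[of "?C \<union> C1" C2] card_Un_le[of "?C \<union> C1 \<union> C2" C3]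
        C1(2) C2(2) C3(2) by linarith
  qed
  moreover have "?C \<union> C1 \<union> C2 \<union> C3 \<subseteq> verts G"
    using pq(1,2) rs(1,2) sub C1(1) C2(1) C3(1) by auto
  ultimately show ?thesis
    by blast
qed

end
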